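(* Let $N$ be a positive integer, let $B$ be the $N\times N$ real upper bidiagonal matrix with diagonal entries $\sqrt{q_1},\dots,\sqrt{q_N}$ and upper subdiagonal entries $\sqrt{e_1},\dots,\sqrt{e_{N-1}}$, where all $q_i>0$ and $e_i>0$. Let $\check B_i=1/q_i$ for $i=1,\dots,N$ and $F_i=e_i/q_i$ for $i=1,\dots,N-1$. Let $g_i^{(1)}$ and $G_i^{(1)}$ for $i=1,\dots,N$ be quantities which satisfy the recurrence relation $$g_N^{(1)}=0,\qquad G_N^{(1)}=\check B_N,$$ $$g_i^{(1)}=F_i\,G_{i+1}^{(1)},\qquad G_i^{(1)}=g_i^{(1)}+\check B_i,\qquad i=1,\dots,N-1.$$ Let $g_i^{(M)}$ for $i=1,\dots,N$ and $M=2,3,\dots$ be quantities which satisfy the recurrence relation $$g_N^{(M)}=0,$$ $$g_i^{(M)}=F_i\,g_{i+1}^{(M)}+G_{i+1}^{(1)}\,g_i^{(M-1)}+\sum_{k=2}^{M-1}g_{i+1}^{(k)}\,g_i^{(M-k)},\qquad i=1,\dots,N-1.$$ Let $G_i^{(M)}$ for $i=1,\dots,N$ and $M=2,3,\dots$ be quantities which satisfy the recurrence relation $$G_i^{(M)}=M\,g_i^{(M)}+G_i^{(1)}\,G_i^{(M-1)}+\sum_{k=2}^{M-1}g_i^{(k)}\,G_i^{(M-k)}.$$ Then, for an arbitrary positive integer $M$, the trace $J_M(B)$ is given by $$J_M(B)=\sum_{i=1}^{N}G_i^{(M)}.$$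
   Context: The matrix $B$ has $(i,i)$-entry $\sqrt{q_i}$ ($i=1,\dots,N$), $(i,i+1)$-entry $\sqrt{e_i}$ ($i=1,\dots,N-1$), and all other entries zero. For a positive integer $M$, $J_M(B)=\mathrm{Tr}\left((B^{\top}B)^{-M}\right)=\mathrm{Tr}\left((BB^{\top})^{-M}\right)$. Convention: $\sum_{i=j}^{k}=0$ if $j>k$. *)

theory Defs
  imports Complex_Main "Jordan_Normal_Form.Gauss_Jordan_Elimination"
    "Jordan_Normal_Form.Determinant"
begin

definition mat_trace :: "'a :: comm_monoid_add mat \<Rightarrow> 'a" where
  "mat_trace A = (\<Sum>i<dim_row A. A $$ (i, i))"

text \<open>\<open>mat_neg_pow A M\<close> is \<open>A\<close> to the power \<open>- M\<close>; it is meaningful only for invertible \<open>A\<close>,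
  since \<^const>\<open>mat_inverse\<close> is \<^const>\<open>None\<close> otherwise.\<close>

definition mat_neg_pow :: "'a :: field mat \<Rightarrow> nat \<Rightarrow> 'a mat" where
  "mat_neg_pow A M = the (mat_inverse A) ^\<^sub>m M"

text \<open>Matrix positions start at 0, whereas the families \<open>q\<close> and \<open>e\<close> are indexed from 1.\<close>

definition bidiag :: "nat \<Rightarrow> (nat \<Rightarrow> real) \<Rightarrow> (nat \<Rightarrow> real) \<Rightarrow> real mat" where
  "bidiag N q e = mat N N (\<lambda>(i, j).
     if j = i then sqrt (q (i + 1)) else if j = i + 1 then sqrt (e (i + 1)) else 0)"

definition inv_trace :: "nat \<Rightarrow> real mat \<Rightarrow> real" where
  "inv_trace M B = mat_trace (mat_neg_pow (B\<^sup>T * B) M)"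

lemma bidiag_carrier: "bidiag N q e \<in> carrier_mat N N"
  by (simp add: bidiag_def)

lemma det_bidiag_nonzero:
  assumes "\<And>i. i \<in> {1..N} \<Longrightarrow> q i > 0"
  shows "det (bidiag N q e) \<noteq> 0"
proof -
  have "upper_triangular (bidiag N q e)"
    by (auto simp: bidiag_def upper_triangular_def)
  then have "det (bidiag N q e) = prod_list (diag_mat (bidiag N q e))"
    using bidiag_carrier by (rule det_upper_triangular)
  moreover have "0 \<notin> set (diag_mat (bidiag N q e))"
  proof
    assume "0 \<in> set (diag_mat (bidiag N q e))"
    then obtain i where i: "i < N" and z: "sqrt (q (i + 1)) = 0"
      by (auto simp: diag_mat_def bidiag_def)
    have "q (i + 1) > 0" using assms[of "i + 1"] i by simp
    with z show False by simp
  qed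
  ultimately show ?thesis by (simp add: prod_list_zero_iff)
qed

lemma mat_inverse_eqI:
  fixes A :: "'a :: field mat"
  assumes A: "A \<in> carrier_mat n n" and X: "X \<in> carrier_mat n n" and AX: "A * X = 1\<^sub>m n"
  shows "mat_inverse A = Some X"
proof -
  have XA: "X * A = 1\<^sub>m n" using mat_mult_left_right_inverse[OF A X AX] .
  show ?thesis
  proof (cases "mat_inverse A")
    case None
    have "A \<in> Units (ring_mat TYPE('a) n ())"
      using A X AX XA by (auto simp: Units_def ring_mat_def)
    with mat_inverse(1)[OF A None, of "()"] show ?thesis by blast
  next
    case (Some Y)
    from mat_inverse(2)[OF A Some]
    have YA: "Y * A = 1\<^sub>m n" and Y: "Y \<in> carrier_mat n n" by auto
    have "Y = Y * (A * X)" using AX Y by simp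
    also have "\<dots> = (Y * A) * X" using Y A X by (simp add: assoc_mult_mat)
    also have "\<dots> = X" using YA X by simp
    finally show ?thesis using Some by simp
  qed
qed

lemma mat_trace_comm:
  fixes A :: "'a :: comm_semiring_0 mat"
  assumes A: "A \<in> carrier_mat n m" and B: "B \<in> carrier_mat m n"
  shows "mat_trace (A * B) = mat_trace (B * A)"
proof -
  have "mat_trace (A * B) = (\<Sum>i<n. \<Sum>k<m. A $$ (i, k) * B $$ (k, i))"
    using A B by (auto simp: mat_trace_def scalar_prod_def lessThan_atLeast0 intro!: sum.cong)
  also have "\<dots> = (\<Sum>k<m. \<Sum>i<n. B $$ (k, i) * A $$ (i, k))"
    by (subst sum.swap) (simp add: mult.commute)
  also have "\<dots> = mat_trace (B * A)"
    using A B by (auto simp: mat_trace_def scalar_prod_def lessThan_atLeast0 intro!: sum.cong)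
  finally show ?thesis .
qed

lemma pow_mat_mult_shift:
  fixes A :: "'a :: semiring_1 mat"
  assumes A: "A \<in> carrier_mat n n" and B: "B \<in> carrier_mat n n"
  shows "(A * B) ^\<^sub>m Suc k = A * ((B * A) ^\<^sub>m k * B)"
proof (induction k)
  case 0
  show ?case using A B by simp
next
  case (Suc k)
  have P: "(B * A) ^\<^sub>m k \<in> carrier_mat n n" using A B by simp
  have "(A * B) ^\<^sub>m Suc (Suc k) = A * ((B * A) ^\<^sub>m k * B) * (A * B)"
    using Suc by simp
  also have "\<dots> = A * ((B * A) ^\<^sub>m k * (B * A) * B)"
  proof -
    let ?P = "(B * A) ^\<^sub>m k"
    have PB: "?P * B \<in> carrier_mat n n" and AB: "A * B \<in> carrier_mat n n"
      and BA: "B * A \<in> carrier_mat n n" using A B P by auto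
    have "A * (?P * B) * (A * B) = A * (?P * B * (A * B))"
      using A PB AB by (rule assoc_mult_mat)
    also have "?P * B * (A * B) = ?P * (B * (A * B))"
      using P B AB by (rule assoc_mult_mat)
    also have "B * (A * B) = B * A * B"
      using B A B by (rule assoc_mult_mat[symmetric])
    also have "?P * (B * A * B) = ?P * (B * A) * B"
      using P BA B by (rule assoc_mult_mat[symmetric])
    finally show ?thesis .
  qed
  finally show ?case by simp
qed

lemma mat_trace_pow_comm:
  fixes A :: "'a :: comm_semiring_1 mat"
  assumes A: "A \<in> carrier_mat n n" and B: "B \<in> carrier_mat n n"
  shows "mat_trace ((A * B) ^\<^sub>m k) = mat_trace ((B * A) ^\<^sub>m k)"
proof (cases k)
  case 0
  then show ?thesis using A B by simp
next
  case (Suc l)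
  have P: "(B * A) ^\<^sub>m l \<in> carrier_mat n n" using A B by simp
  have "mat_trace ((A * B) ^\<^sub>m k) = mat_trace ((B * A) ^\<^sub>m l * B * A)"
    unfolding Suc pow_mat_mult_shift[OF A B] using A B P
    by (subst mat_trace_comm[of _ n n]) auto
  also have "(B * A) ^\<^sub>m l * B * A = (B * A) ^\<^sub>m k"
    unfolding Suc using A B P by (simp add: assoc_mult_mat[of _ n n _ n _ n])
  finally show ?thesis .
qed

lemma mat_inverse_gram:
  fixes B :: "'a :: field mat"
  assumes B: "B \<in> carrier_mat n n" and X: "X \<in> carrier_mat n n" and BX: "B * X = 1\<^sub>m n"
  shows "mat_inverse (B\<^sup>T * B) = Some (X * X\<^sup>T)"
    and "mat_inverse (B * B\<^sup>T) = Some (X\<^sup>T * X)"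
proof -
  have XB: "X * B = 1\<^sub>m n" using mat_mult_left_right_inverse[OF B X BX] .
  have t: "B\<^sup>T * X\<^sup>T = 1\<^sub>m n"
    using transpose_mult[OF X B] XB by simp
  have BT: "B\<^sup>T \<in> carrier_mat n n" and XT: "X\<^sup>T \<in> carrier_mat n n" using B X by auto
  have "B\<^sup>T * B * (X * X\<^sup>T) = B\<^sup>T * (B * X * X\<^sup>T)"
    using B X BT XT by (simp add: assoc_mult_mat[of _ n n _ n _ n])
  also have "\<dots> = 1\<^sub>m n" using BX XT t by simp
  finally show "mat_inverse (B\<^sup>T * B) = Some (X * X\<^sup>T)"
    using B X BT XT by (intro mat_inverse_eqI[of _ n]) auto
  have "B * B\<^sup>T * (X\<^sup>T * X) = B * (B\<^sup>T * X\<^sup>T * X)"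
    using B X BT XT by (simp add: assoc_mult_mat[of _ n n _ n _ n])
  also have "\<dots> = 1\<^sub>m n" using BX X t by simp
  finally show "mat_inverse (B * B\<^sup>T) = Some (X\<^sup>T * X)"
    using B X BT XT by (intro mat_inverse_eqI[of _ n]) auto
qed

lemma bidiag_inverse_exists:
  assumes "\<And>i. i \<in> {1..N} \<Longrightarrow> q i > 0"
  obtains X where "X \<in> carrier_mat N N" "bidiag N q e * X = 1\<^sub>m N"
proof -
  have "bidiag N q e \<in> Units (ring_mat TYPE(real) N ())"
    using det_non_zero_imp_unit[OF bidiag_carrier det_bidiag_nonzero[OF assms]] .
  then show thesis using that by (auto simp: Units_def ring_mat_def)
qed

text \<open>The inverses exist for positive \<open>q\<close>, and the two customary forms of the trace agree.\<close>

lemma inv_trace_eq: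
  assumes "\<And>i. i \<in> {1..N} \<Longrightarrow> q i > 0"
  shows "inv_trace M (bidiag N q e)
    = mat_trace (mat_neg_pow (bidiag N q e * (bidiag N q e)\<^sup>T) M)"
proof -
  obtain X where X: "X \<in> carrier_mat N N" and BX: "bidiag N q e * X = 1\<^sub>m N"
    using bidiag_inverse_exists[OF assms] .
  show ?thesis
    using X mat_trace_pow_comm[of X N "X\<^sup>T" M]
    by (simp add: inv_trace_def mat_neg_pow_def mat_inverse_gram[OF bidiag_carrier X BX])
qed

end

theory Submission
  imports Defs "HOL-Computational_Algebra.Formal_Power_Series"
begin

text \<open>In formal power series, let \<open>d i\<close> be the pivots of \<open>B B\<^sup>T - X\<close> when eliminating from the last
  row. Since \<open>det (B B\<^sup>T - X)\<close> is their product, the sum of \<open>- X d' i / d i\<close> is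
  \<open>X Tr ((B B\<^sup>T - X)\<^sup>-\<^sup>1)\<close>, whose coefficient at \<open>X ^ M\<close> is the trace in question; we derive this
  from the diagonal of the resolvent without using the determinant. Write \<open>d i = q i (1 - h i)\<close> and
  \<open>h i = X / q i + U i\<close>. The pivot recurrence becomes \<open>U i (1 - h (i + 1)) = F i h (i + 1)\<close>, which is
  the recurrence for \<open>g\<close> as the coefficients of \<open>U\<close>; and \<open>W i = - X d' i / d i\<close> satisfies
  \<open>W i (1 - h i) = X h' i\<close>, which is the recurrence for \<open>G\<close> as the coefficients of \<open>W\<close>.\<close>

lemma pow_mat_Suc_left:
  fixes A :: "'a :: semiring_1 mat"
  assumes A: "A \<in> carrier_mat n n"
  shows "A ^\<^sub>m Suc k = A * A ^\<^sub>m k"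
proof (induction k)
  case 0
  show ?case using A by simp
next
  case (Suc k)
  have P: "A ^\<^sub>m k \<in> carrier_mat n n" using A by simp
  have "A ^\<^sub>m Suc (Suc k) = A * A ^\<^sub>m k * A" using Suc by simp
  also have "\<dots> = A * (A ^\<^sub>m k * A)" using A P A by (rule assoc_mult_mat)
  finally show ?case by simp
qed

lemma transpose_pow_mat:
  fixes A :: "'a :: comm_semiring_1 mat"
  assumes A: "A \<in> carrier_mat n n"
  shows "(A ^\<^sub>m k)\<^sup>T = A\<^sup>T ^\<^sub>m k"
proof (induction k)
  case 0
  show ?case using A by simp
next
  case (Suc k)
  have P: "A ^\<^sub>m k \<in> carrier_mat n n" using A by simp
  have "(A ^\<^sub>m Suc k)\<^sup>T = A\<^sup>T * A\<^sup>T ^\<^sub>m k"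
    using transpose_mult[OF P A] Suc by simp
  also have "\<dots> = A\<^sup>T ^\<^sub>m Suc k"
    using A by (intro pow_mat_Suc_left[symmetric, of _ n]) simp
  finally show ?case .
qed

text \<open>Elimination from the last row writes the tridiagonal matrix with diagonal \<open>a i - X\<close> and
  off-diagonal \<open>s i\<close> as \<open>U D U\<^sup>T\<close>, where \<open>D\<close> has diagonal \<open>d\<close> and \<open>U\<close> is unit upper
  bidiagonal with entries \<open>w\<close>. The matrix \<open>Y = D U\<^sup>T R\<close> is then the inverse of \<open>U\<close>, hence unit
  upper triangular. Setting \<open>s 0 = s N = 0\<close> makes the first and last rows uniform with the others.\<close>

lemma tridiag_resolvent_trace:
  fixes a s d :: "nat \<Rightarrow> 'a :: field fps" and R :: "nat \<Rightarrow> nat \<Rightarrow> 'a fps"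
  assumes s0: "s 0 = 0" and sN: "s N = 0"
    and a': "\<And>i. i \<in> {1..N} \<Longrightarrow> fps_deriv (a i) = 0"
    and s': "\<And>i. i \<in> {1..N} \<Longrightarrow> fps_deriv (s i) = 0"
    and d0: "\<And>i. i \<in> {1..N} \<Longrightarrow> fps_nth (d i) 0 \<noteq> 0"
    and d: "\<And>i. i \<in> {1..N} \<Longrightarrow> d i = a i - fps_X - s i ^ 2 * inverse (d (i + 1))"
    and sym: "\<And>i j. i \<in> {1..N} \<Longrightarrow> j \<in> {1..N} \<Longrightarrow> R i j = R j i"
    and R: "\<And>i j. i \<in> {1..N} \<Longrightarrow> j \<in> {1..N} \<Longrightarrow>
      s (i - 1) * R (i - 1) j + (a i - fps_X) * R i j + s i * R (i + 1) j = (if i = j then 1 else 0)"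
  shows "(\<Sum>i = 1..N. fps_deriv (d i) * inverse (d i)) = - (\<Sum>i = 1..N. R i i)"
proof -
  define w where "w = (\<lambda>i. s i * inverse (d (i + 1)))"
  define Y where "Y = (\<lambda>i j. d i * (w (i - 1) * R (i - 1) j + R i j))"
  have w0: "w 0 = 0" and wN: "w N = 0" using s0 sN by (simp_all add: w_def)
  have inv: "d i * inverse (d i) = 1" if "i \<in> {1..N}" for i
    using inverse_mult_eq_1'[OF d0[OF that]] by simp
  \<comment> \<open>At \<open>i = N\<close> the pivot \<open>d (N + 1)\<close> is unconstrained and
    may fail to be invertible; there both sides vanish because \<open>s N = 0\<close>.\<close>
  have dw: "d (i + 1) * w i = s i" if "i \<le> N" for i
  proof (cases "i = N")
    case False
    then have "d (i + 1) * inverse (d (i + 1)) = 1" using that by (intro inv) auto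
    then show ?thesis unfolding w_def by (metis mult.left_commute mult.right_neutral)
  qed (use sN wN in simp)
  \<comment> \<open>Row \<open>i\<close> of \<open>U Y = 1\<close>: the products of pivots with
    \<open>w\<close> restore the off-diagonal entries \<open>s\<close>, and
    \<open>d i + s i * w i\<close> restores the diagonal.\<close>
  have UY: "Y i j + w i * Y (i + 1) j = (if i = j then 1 else 0)"
    if i: "i \<in> {1..N}" and j: "j \<in> {1..N}" for i j
  proof -
    have e1: "d i * w (i - 1) = s (i - 1)" using dw[of "i - 1"] i by (cases i) auto
    have e2: "d (i + 1) * w i = s i" using dw[of i] i by simp
    have e3: "d i = a i - fps_X - s i * w i"
      using d[OF i] by (simp add: w_def power2_eq_square mult.assoc)
    have "Y i j + w i * Y (i + 1) j = (d i * w (i - 1)) * R (i - 1) j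
        + (d i + (d (i + 1) * w i) * w i) * R i j + (d (i + 1) * w i) * R (i + 1) j"
      by (simp add: Y_def algebra_simps)
    also have "\<dots> = s (i - 1) * R (i - 1) j + (a i - fps_X) * R i j + s i * R (i + 1) j"
      unfolding e1 e2 by (subst e3) simp
    finally show ?thesis using R[OF i j] by simp
  qed
  \<comment> \<open>Back substitution starting at the last row, where \<open>w N = 0\<close> leaves
    \<open>Y N j\<close> alone.\<close>
  have Ylow: "Y i j = 0" if "i \<le> N" "j \<in> {1..N}" "j < i" for i j
    using that
  proof (induction i rule: inc_induct)
    case base
    then show ?case using UY[of N j] wN by auto
  next
    case (step i)
    then show ?case using UY[of i j] by auto
  qed
  have Ydiag: "Y i i = 1" if i: "i \<in> {1..N}" for i
  proof (cases "i = N")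
    case True
    then show ?thesis using UY[OF i i] wN by simp
  next
    case False
    then show ?thesis using UY[OF i i] Ylow[of "i + 1" i] i by simp
  qed
  \<comment> \<open>By symmetry of \<open>R\<close>, the equation \<open>Y i (i - 1) = 0\<close>
    expresses \<open>R (i - 1) i\<close> through a diagonal entry; then \<open>Y i i = 1\<close>
    involves the diagonal of \<open>R\<close> only.\<close>
  have dinv: "inverse (d i) = R i i - w (i - 1) ^ 2 * R (i - 1) (i - 1)" if i: "i \<in> {1..N}" for i
  proof -
    have "R (i - 1) i * w (i - 1) = - (w (i - 1) ^ 2 * R (i - 1) (i - 1))"
    proof (cases "i = 1")
      case False
      then have j: "i - 1 \<in> {1..N}" using i by auto
      have "d i * (w (i - 1) * R (i - 1) (i - 1) + R i (i - 1)) = 0"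
        using Ylow[of i "i - 1"] i j by (simp add: Y_def)
      moreover have "d i \<noteq> 0" using d0[OF i] by auto
      ultimately have "R i (i - 1) = - (w (i - 1) * R (i - 1) (i - 1))"
        by (simp add: eq_neg_iff_add_eq_0 add.commute)
      then have "R (i - 1) i = - (w (i - 1) * R (i - 1) (i - 1))" using sym[OF i j] by simp
      from arg_cong[OF this, of "\<lambda>x. x * w (i - 1)"] show ?thesis
        by (simp only: power2_eq_square mult_minus_left mult_minus_right mult_ac)
    qed (simp add: w0)
    then have "d i * (R i i - w (i - 1) ^ 2 * R (i - 1) (i - 1)) = 1"
      using Ydiag[OF i] by (simp add: Y_def algebra_simps)
    from arg_cong[OF this, of "\<lambda>x. inverse (d i) * x"] show ?thesis
      unfolding mult.assoc[symmetric] mult.commute[of "inverse (d i)" "d i"] inv[OF i] by simp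
  qed
  \<comment> \<open>Since \<open>s i\<close> is constant, the derivative of \<open>- s^2 / d\<close>
    is \<open>s^2 d' / d^2 = w^2 d'\<close>.\<close>
  have d': "fps_deriv (d i) = - 1 + w i ^ 2 * fps_deriv (d (i + 1))" if i: "i \<in> {1..N}" for i
  proof (cases "i = N")
    case True
    then have "d i = a i - fps_X" using d[OF i] sN by simp
    then show ?thesis using True wN a'[OF i] by simp
  next
    case False
    then have "fps_nth (d (i + 1)) 0 \<noteq> 0" using i by (intro d0) auto
    then show ?thesis
      using a'[OF i] s'[OF i] by (subst d[OF i])
        (simp add: fps_inverse_deriv w_def power2_eq_square algebra_simps)
  qed
  \<comment> \<open>The shift collects all terms at \<open>R i i\<close>, whose coefficient
    \<open>d' i - w i ^ 2 * d' (i + 1)\<close> is then \<open>- 1\<close>. The boundary terms vanish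
    because \<open>w 0 = w N = 0\<close>.\<close>
  have shift: "(\<Sum>i = 1..N. fps_deriv (d i) * (w (i - 1) ^ 2 * R (i - 1) (i - 1)))
      = (\<Sum>i = 1..N. fps_deriv (d (i + 1)) * (w i ^ 2 * R i i))" (is "?L = sum ?f _")
  proof -
    have "?L = (\<Sum>i = 0..<N. ?f i)"
      by (rule sum.reindex_bij_witness[of _ "\<lambda>i. i + 1" "\<lambda>i. i - 1"]) auto
    also have "\<dots> = sum ?f {0..N}"
      using wN by (simp add: sum.last_plus atLeastLessThanSuc_atLeastAtMost[symmetric])
    also have "\<dots> = sum ?f {1..N}" using w0 by (simp add: sum.atLeast_Suc_atMost)
    finally show ?thesis .
  qed
  have "(\<Sum>i = 1..N. fps_deriv (d i) * inverse (d i))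
      = (\<Sum>i = 1..N. fps_deriv (d i) * R i i)
        - (\<Sum>i = 1..N. fps_deriv (d i) * (w (i - 1) ^ 2 * R (i - 1) (i - 1)))"
    unfolding sum_subtractf[symmetric] by (intro sum.cong) (simp_all add: dinv right_diff_distrib)
  also have "\<dots> = (\<Sum>i = 1..N. - R i i)"
    unfolding shift sum_subtractf[symmetric]
    by (intro sum.cong refl) (simp add: d' algebra_simps)
  finally show ?thesis by (simp add: sum_negf)
qed

text \<open>This is \<open>(T - X) R = 1\<close> for the resolvent \<open>R\<close>, the power series of the \<open>S ^ (m + 1)\<close>.\<close>

lemma resolvent_series:
  fixes T S :: "'a :: field mat"
  assumes T: "T \<in> carrier_mat n n" and S: "S \<in> carrier_mat n n" and TS: "T * S = 1\<^sub>m n"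
    and i: "i < n" and j: "j < n"
  shows "(\<Sum>k<n. fps_const (T $$ (i, k)) * Abs_fps (\<lambda>m. (S ^\<^sub>m Suc m) $$ (k, j)))
      - fps_X * Abs_fps (\<lambda>m. (S ^\<^sub>m Suc m) $$ (i, j)) = (if i = j then 1 else 0)"
proof (rule fps_ext)
  fix m
  have P: "S ^\<^sub>m m \<in> carrier_mat n n" and P': "S ^\<^sub>m Suc m \<in> carrier_mat n n" using S by auto
  have "T * S ^\<^sub>m Suc m = T * S * S ^\<^sub>m m"
    unfolding pow_mat_Suc_left[OF S] using T S P by (rule assoc_mult_mat[symmetric])
  then have "T * S ^\<^sub>m Suc m = S ^\<^sub>m m" unfolding TS left_mult_one_mat[OF P] .
  moreover have "(T * S ^\<^sub>m Suc m) $$ (i, j) = (\<Sum>k<n. T $$ (i, k) * (S ^\<^sub>m Suc m) $$ (k, j))"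
    using carrier_matD[OF T] carrier_matD[OF P'] i j
    by (simp add: scalar_prod_def lessThan_atLeast0 del: pow_mat.simps)
  ultimately have "(\<Sum>k<n. T $$ (i, k) * (S ^\<^sub>m Suc m) $$ (k, j)) = (S ^\<^sub>m m) $$ (i, j)"
    by simp
  \<comment> \<open>Both \<open>T\<close> and the factor \<open>fps_X\<close> lower the exponent of
    \<open>S\<close> by one, so the coefficients cancel except at \<open>m = 0\<close>, where
    \<open>S ^ 0 = 1\<close> remains.\<close>
  then show "fps_nth ((\<Sum>k<n. fps_const (T $$ (i, k)) * Abs_fps (\<lambda>m. (S ^\<^sub>m Suc m) $$ (k, j)))
      - fps_X * Abs_fps (\<lambda>m. (S ^\<^sub>m Suc m) $$ (i, j))) m
      = fps_nth (if i = j then 1 else (0 :: 'a fps)) m"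
    using i j S by (cases m) (simp_all add: fps_sum_nth del: pow_mat.simps, simp_all)
qed

lemma bidiag_sum:
  assumes "i < N"
  shows "(\<Sum>l<N. bidiag N q e $$ (i, l) * f l)
    = sqrt (q (i + 1)) * f i + (if i + 1 < N then sqrt (e (i + 1)) * f (i + 1) else 0)"
proof -
  have "(\<Sum>l<N. bidiag N q e $$ (i, l) * f l)
      = (\<Sum>l<N. (if l = i then sqrt (q (i + 1)) * f l else 0)
          + (if l = i + 1 then sqrt (e (i + 1)) * f l else 0))"
    using assms by (intro sum.cong) (auto simp: bidiag_def)
  then show ?thesis using assms by (simp add: sum.distrib)
qed

text \<open>Row \<open>i\<close> of the bidiagonal matrix is supported on columns \<open>i\<close>
  and \<open>i + 1\<close>, so only equal or adjacent rows overlap. Positivity collapses the squared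
  roots on the diagonal.\<close>

lemma bidiag_gram_index:
  assumes q: "\<And>i. i \<in> {1..N} \<Longrightarrow> q i > 0" and e: "\<And>i. i \<in> {1..N - 1} \<Longrightarrow> e i > 0"
    and i: "i < N" and k: "k < N"
  shows "(bidiag N q e * (bidiag N q e)\<^sup>T) $$ (i, k) =
    (if k = i then q (i + 1) + (if i + 1 < N then e (i + 1) else 0)
     else if k = i + 1 then sqrt (e (i + 1)) * sqrt (q (i + 2))
     else if i = k + 1 then sqrt (e i) * sqrt (q (i + 1)) else 0)"
proof -
  have "(bidiag N q e * (bidiag N q e)\<^sup>T) $$ (i, k)
      = (\<Sum>l<N. bidiag N q e $$ (i, l) * bidiag N q e $$ (k, l))"
    using i k bidiag_carrier[of N q e] by (simp add: scalar_prod_def lessThan_atLeast0)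
  also have "\<dots> = sqrt (q (i + 1)) * bidiag N q e $$ (k, i)
      + (if i + 1 < N then sqrt (e (i + 1)) * bidiag N q e $$ (k, i + 1) else 0)"
    by (rule bidiag_sum[OF i])
  moreover have "e (i + 1) \<ge> 0" if "i + 1 < N" using that by (intro less_imp_le e) auto
  moreover have "q (i + 1) \<ge> 0" using q[of "i + 1"] i by simp
  ultimately show ?thesis
    using i k by (auto simp: bidiag_def simp del: index_mult_mat)
qed

text \<open>The Cauchy product loses both end terms. The term \<open>k = 1\<close> is split off
  because the recurrences have \<open>G 1\<close> there, but \<open>g k\<close> for larger
  \<open>k\<close>.\<close>

lemma fps_mult_nth_no_const:
  fixes f h :: "'a :: semiring_1 fps"
  assumes "fps_nth f 0 = 0" and "fps_nth h 0 = 0" and m: "m \<ge> 2"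
  shows "fps_nth (f * h) m = fps_nth f 1 * fps_nth h (m - 1)
    + (\<Sum>k = 2..m - 1. fps_nth f k * fps_nth h (m - k))"
proof -
  obtain n where n: "m = Suc (Suc n)" using m by (metis add_2_eq_Suc le_Suc_ex)
  show ?thesis
    unfolding fps_mult_nth n using assms(1,2)
    by (simp add: sum.atLeast_Suc_atMost numeral_2_eq_2 add.assoc)
qed

theorem theorem20:
  fixes N M :: nat
    and q e Bc F :: "nat \<Rightarrow> real"
    and g G :: "nat \<Rightarrow> nat \<Rightarrow> real"
  assumes N: "N \<ge> 1"
    and q_pos: "\<And>i. i \<in> {1..N} \<Longrightarrow> q i > 0"
    and e_pos: "\<And>i. i \<in> {1..N - 1} \<Longrightarrow> e i > 0"
    and Bc: "\<And>i. i \<in> {1..N} \<Longrightarrow> Bc i = 1 / q i"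
    and F: "\<And>i. i \<in> {1..N - 1} \<Longrightarrow> F i = e i / q i"
    and g1_N: "g 1 N = 0"
    and G1_N: "G 1 N = Bc N"
    and g1: "\<And>i. i \<in> {1..N - 1} \<Longrightarrow> g 1 i = F i * G 1 (i + 1)"
    and G1: "\<And>i. i \<in> {1..N - 1} \<Longrightarrow> G 1 i = g 1 i + Bc i"
    and g_N: "\<And>m. m \<ge> 2 \<Longrightarrow> g m N = 0"
    and g_rec: "\<And>m i. m \<ge> 2 \<Longrightarrow> i \<in> {1..N - 1} \<Longrightarrow>
      g m i = F i * g m (i + 1) + G 1 (i + 1) * g (m - 1) i
        + (\<Sum>k = 2..m - 1. g k (i + 1) * g (m - k) i)"
    and G_rec: "\<And>m i. m \<ge> 2 \<Longrightarrow> i \<in> {1..N} \<Longrightarrow>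
      G m i = real m * g m i + G 1 i * G (m - 1) i
        + (\<Sum>k = 2..m - 1. g k i * G (m - k) i)"
    and M: "M \<ge> 1"
  shows "inv_trace M (bidiag N q e) = (\<Sum>i = 1..N. G M i)"
proof -

  \<comment> \<open>Generating functions of the recurrences\<close>
  define h where "h = (\<lambda>i. Abs_fps (\<lambda>m. if m = 0 then 0 else if m = 1 then G 1 i else g m i))"
  define U where "U = (\<lambda>i. Abs_fps (\<lambda>m. if m = 0 then 0 else g m i))"
  define W where "W = (\<lambda>i. Abs_fps (\<lambda>m. if m = 0 then 0 else G m i))"
  define d where "d = (\<lambda>i. fps_const (q i) * (1 - h i))"
  \<comment> \<open>The guards here and in \<open>a\<close> discard \<open>e 0\<close>,
    \<open>e N\<close> and \<open>q (N + 1)\<close>, about which nothing is assumed.\<close>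
  define s where "s = (\<lambda>i. if 1 \<le> i \<and> i < N then fps_const (sqrt (e i) * sqrt (q (i + 1))) else 0)"
  define a where "a = (\<lambda>i. fps_const (q i + (if i < N then e i else 0)))"
  have q_nz: "q i \<noteq> 0" if "i \<in> {1..N}" for i using q_pos[OF that] by simp
  have h0: "fps_nth (1 - h i) 0 \<noteq> 0" for i by (simp add: h_def)
  have h_inv: "(1 - h i) * inverse (1 - h i) = 1" for i by (rule inverse_mult_eq_1'[OF h0])
  have h_div: "x = y * inverse (1 - h i)" if "x * (1 - h i) = y" for x y i
    unfolding that[symmetric] mult.assoc h_inv by simp
  have hU: "h i = fps_const (1 / q i) * fps_X + U i" if i: "i \<in> {1..N}" for i
  proof (rule fps_ext)
    fix m
    have "G 1 i = 1 / q i + g 1 i"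
      using G1[of i] G1_N g1_N Bc[OF i] i by (cases "i = N") auto
    then show "fps_nth (h i) m = fps_nth (fps_const (1 / q i) * fps_X + U i) m"
      by (simp add: h_def U_def fps_X_def)
  qed
  have U_N: "U N = 0"
  proof (rule fps_ext)
    fix m
    show "fps_nth (U N) m = fps_nth 0 m" using g1_N g_N[of m] by (cases "m = 1") (auto simp: U_def)
  qed
  have U_rec: "U i = fps_const (F i) * h (i + 1) + h (i + 1) * U i" if i: "i \<in> {1..N - 1}" for i
  proof (rule fps_ext)
    fix m :: nat
    consider "m = 0" | "m = 1" | "m \<ge> 2" by linarith
    then show "fps_nth (U i) m = fps_nth (fps_const (F i) * h (i + 1) + h (i + 1) * U i) m"
    proof cases
      case 3
      have "(\<Sum>k = 2..m - 1. fps_nth (h (i + 1)) k * fps_nth (U i) (m - k))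
          = (\<Sum>k = 2..m - 1. g k (i + 1) * g (m - k) i)"
        using 3 by (intro sum.cong) (auto simp: h_def U_def)
      then have "fps_nth (h (i + 1) * U i) m = G 1 (i + 1) * g (m - 1) i
          + (\<Sum>k = 2..m - 1. g k (i + 1) * g (m - k) i)"
        using 3 by (subst fps_mult_nth_no_const) (auto simp: h_def U_def)
      then show ?thesis using 3 g_rec[OF 3 i] by (simp add: h_def U_def)
    qed (use g1[OF i] in \<open>simp_all add: h_def U_def\<close>)
  qed
  \<comment> \<open>The operator \<open>X d/dX\<close> multiplies coefficient \<open>m\<close> by
    \<open>m\<close>, which yields the term \<open>real m * g m i\<close>.\<close>
  have W_rec: "W i = fps_X * fps_deriv (h i) + h i * W i" if i: "i \<in> {1..N}" for i
  proof (rule fps_ext)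
    fix m :: nat
    consider "m = 0" | "m = 1" | "m \<ge> 2" by linarith
    then show "fps_nth (W i) m = fps_nth (fps_X * fps_deriv (h i) + h i * W i) m"
    proof cases
      case 3
      have "(\<Sum>k = 2..m - 1. fps_nth (h i) k * fps_nth (W i) (m - k))
          = (\<Sum>k = 2..m - 1. g k i * G (m - k) i)"
        using 3 by (intro sum.cong) (auto simp: h_def W_def)
      then have "fps_nth (h i * W i) m = G 1 i * G (m - 1) i
          + (\<Sum>k = 2..m - 1. g k i * G (m - k) i)"
        using 3 by (subst fps_mult_nth_no_const) (auto simp: h_def W_def)
      then show ?thesis using 3 G_rec[OF 3 i] by (simp add: h_def W_def)
    qed (simp_all add: h_def W_def)
  qed

  \<comment> \<open>Pivot recurrence and logarithmic derivative\<close>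
  have d_rec: "d i = a i - fps_X - s i ^ 2 * inverse (d (i + 1))" if i: "i \<in> {1..N}" for i
  proof -
    have X: "fps_const (q i) * (fps_const (1 / q i) * fps_X) = (fps_X :: real fps)"
      using q_nz[OF i] by (simp add: mult.assoc[symmetric])
    have di: "d i = fps_const (q i) - fps_X - fps_const (q i) * U i"
      unfolding d_def hU[OF i] right_diff_distrib distrib_left X by simp
    show ?thesis
    proof (cases "i = N")
      case True
      then show ?thesis using di U_N by (simp add: a_def s_def)
    next
      case False
      then have i': "i \<in> {1..N - 1}" "i + 1 \<in> {1..N}" using i by auto
      have qF: "fps_const (q i) * fps_const (F i) = fps_const (e i)"
        using F[OF i'(1)] q_nz[OF i] by simp
      \<comment> \<open>From \<open>h / (1 - h) = 1 / (1 - h) - 1\<close>, the series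
        \<open>q i * U i\<close> is \<open>e i / (1 - h (i + 1))\<close> minus \<open>e i\<close>:
        the former is \<open>s i ^ 2 / d (i + 1)\<close>, the latter completes
        \<open>a i\<close>.\<close>
      have "U i * (1 - h (i + 1)) = fps_const (F i) * h (i + 1)"
        using U_rec[OF i'(1)] by (simp add: algebra_simps)
      then have "U i = fps_const (F i) * (h (i + 1) * inverse (1 - h (i + 1)))"
        unfolding mult.assoc[symmetric] by (rule h_div)
      also have "h (i + 1) * inverse (1 - h (i + 1))
          = inverse (1 - h (i + 1)) - (1 - h (i + 1)) * inverse (1 - h (i + 1))"
        by (simp only: left_diff_distrib mult_1_left diff_diff_eq2 add_diff_cancel_left')
      also note h_inv
      finally have "fps_const (q i) * U i = fps_const (e i) * (inverse (1 - h (i + 1)) - 1)"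
        by (simp only: mult.assoc[symmetric] qF)
      moreover have "s i ^ 2 * inverse (d (i + 1)) = fps_const (e i) * inverse (1 - h (i + 1))"
      proof -
        have "(sqrt (e i) * sqrt (q (i + 1))) ^ 2 = e i * q (i + 1)"
          using e_pos[OF i'(1)] q_pos[OF i'(2)] by (simp add: power_mult_distrib)
        then have "s i ^ 2 = fps_const (e i * q (i + 1))"
          using False i by (simp add: s_def fps_const_power)
        moreover have "inverse (d (i + 1)) = fps_const (inverse (q (i + 1))) * inverse (1 - h (i + 1))"
          by (simp add: d_def fps_inverse_mult fps_const_inverse)
        moreover have "fps_const (e i * q (i + 1)) * fps_const (inverse (q (i + 1))) = fps_const (e i)"
          using q_nz[OF i'(2)] by (simp add: field_simps)
        ultimately show ?thesis by (simp only: mult.assoc[symmetric])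
      qed
      moreover have "a i = fps_const (q i) + fps_const (e i)" using False i by (simp add: a_def)
      moreover have "x - X - y * (z - 1) = x + y - X - y * z" for x y z X :: "real fps"
        by (simp add: algebra_simps)
      ultimately show ?thesis using di by (simp only:)
    qed
  qed
  have W_d: "W i = - (fps_X * (fps_deriv (d i) * inverse (d i)))" if i: "i \<in> {1..N}" for i
  proof -
    have "W i * (1 - h i) = fps_X * fps_deriv (h i)" using W_rec[OF i] by (simp add: algebra_simps)
    then have "W i = fps_X * fps_deriv (h i) * inverse (1 - h i)" by (rule h_div)
    moreover have "fps_deriv (d i) * inverse (d i)
        = (fps_const (q i) * fps_const (inverse (q i))) * (- fps_deriv (h i) * inverse (1 - h i))"
      by (simp add: d_def fps_inverse_mult fps_const_inverse)
    ultimately show ?thesis using q_nz[OF i] by simp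
  qed

  \<comment> \<open>Resolvent of the Gram matrix\<close>
  define B where "B = bidiag N q e"
  have B: "B \<in> carrier_mat N N" unfolding B_def by (rule bidiag_carrier)
  obtain Z where Z: "Z \<in> carrier_mat N N" and BZ: "B * Z = 1\<^sub>m N"
    unfolding B_def using bidiag_inverse_exists[OF q_pos] .
  define S where "S = Z\<^sup>T * Z"
  have inv: "mat_inverse (B * B\<^sup>T) = Some S"
    unfolding S_def by (rule mat_inverse_gram(2)[OF B Z BZ])
  have S: "S \<in> carrier_mat N N" using Z by (simp add: S_def)
  have T: "B * B\<^sup>T \<in> carrier_mat N N" using B by simp
  have TS: "B * B\<^sup>T * S = 1\<^sub>m N"
    using mat_inverse(2)[OF T inv] by simp
  have S_sym: "S\<^sup>T = S" using Z by (simp add: S_def transpose_mult[of _ N N])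
  \<comment> \<open>The junk rows \<open>R 0\<close> and \<open>R (N + 1)\<close> are harmless: in
    the row equations they carry the coefficients \<open>s 0 = 0\<close> and
    \<open>s N = 0\<close>.\<close>
  define R where "R = (\<lambda>i j. Abs_fps (\<lambda>m. (S ^\<^sub>m Suc m) $$ (i - 1, j - 1)))"
  have R_sym: "R i j = R j i" if "i \<in> {1..N}" "j \<in> {1..N}" for i j
  proof -
    have "(S ^\<^sub>m Suc m) $$ (i - 1, j - 1) = (S ^\<^sub>m Suc m) $$ (j - 1, i - 1)" for m
    proof -
      have P: "S ^\<^sub>m Suc m \<in> carrier_mat N N" by (rule pow_carrier_mat[OF S])
      have "(S ^\<^sub>m Suc m)\<^sup>T = S ^\<^sub>m Suc m" using transpose_pow_mat[OF S] S_sym by metis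
      then show ?thesis
        using index_transpose_mat(1)[of "i - 1" "S ^\<^sub>m Suc m" "j - 1"] P S that
        by (auto simp del: pow_mat.simps)
    qed
    then show ?thesis by (simp only: R_def)
  qed
  have R_eq: "s (i - 1) * R (i - 1) j + (a i - fps_X) * R i j + s i * R (i + 1) j
      = (if i = j then 1 else 0)" if i: "i \<in> {1..N}" and j: "j \<in> {1..N}" for i j
  proof -
    \<comment> \<open>Writing \<open>k + 2 = i\<close> avoids truncated subtraction: at
      \<open>i = 1\<close> no \<open>k\<close> qualifies.\<close>
    have "(\<Sum>k<N. fps_const ((B * B\<^sup>T) $$ (i - 1, k)) * R (k + 1) j)
        = (\<Sum>k<N. (if k = i - 1 then a i * R (k + 1) j else 0)
          + (if k = i then s i * R (k + 1) j else 0)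
          + (if k + 2 = i then s (i - 1) * R (k + 1) j else 0))"
      using i unfolding B_def
      by (intro sum.cong refl, subst bidiag_gram_index[OF q_pos e_pos])
        (auto simp: a_def s_def)
    also have "\<dots> = a i * R i j + s i * R (i + 1) j + s (i - 1) * R (i - 1) j"
    proof -
      have "(\<Sum>k<N. if k + 2 = i then s (i - 1) * R (k + 1) j else 0) = s (i - 1) * R (i - 1) j"
      proof (cases "i = 1")
        case False
        then obtain p where "i = p + 2" using i by (auto intro: that[of "i - 2"])
        then show ?thesis using i by simp
      qed (simp add: s_def)
      moreover have "s i = 0" if "\<not> i < N" using that by (simp add: s_def)
      moreover have "i - 1 < N" using i by auto
      ultimately show ?thesis using i by (simp add: sum.distrib)
    qed
    finally show ?thesis
      using resolvent_series[OF T S TS, of "i - 1" "j - 1"] i j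
      by (auto simp: R_def algebra_simps simp del: pow_mat.simps)
  qed

  \<comment> \<open>Comparison of coefficients\<close>
  have "(\<Sum>i = 1..N. fps_deriv (d i) * inverse (d i)) = - (\<Sum>i = 1..N. R i i)"
  proof (rule tridiag_resolvent_trace[OF _ _ _ _ _ d_rec R_sym R_eq])
    show "fps_nth (d i) 0 \<noteq> 0" if "i \<in> {1..N}" for i
      using q_nz[OF that] by (simp add: d_def h_def)
  qed (simp_all add: s_def a_def)
  then have "(\<Sum>i = 1..N. W i) = fps_X * (\<Sum>i = 1..N. R i i)"
    by (simp add: W_d sum_negf flip: sum_distrib_left)
  \<comment> \<open>Coefficient \<open>m\<close> of \<open>R i i\<close> comes from
    \<open>S ^ (m + 1)\<close>, so the factor \<open>fps_X\<close> puts \<open>S ^ M\<close> at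
    degree \<open>M\<close>.\<close>
  then have "fps_nth (\<Sum>i = 1..N. W i) M = fps_nth (fps_X * (\<Sum>i = 1..N. R i i)) M" by simp
  then have "(\<Sum>i = 1..N. G M i) = (\<Sum>i = 1..N. (S ^\<^sub>m M) $$ (i - 1, i - 1))"
    using M by (simp add: fps_sum_nth W_def R_def del: pow_mat.simps)
  also have "\<dots> = (\<Sum>i<N. (S ^\<^sub>m M) $$ (i, i))"
    by (rule sum.reindex_bij_witness[of _ "\<lambda>i. i + 1" "\<lambda>i. i - 1"]) auto
  also have "\<dots> = mat_trace (S ^\<^sub>m M)"
    using S by (simp add: mat_trace_def)
  also have "\<dots> = mat_trace (mat_neg_pow (B * B\<^sup>T) M)"
    by (simp only: mat_neg_pow_def inv option.sel)
  also have "\<dots> = inv_trace M (bidiag N q e)"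
    unfolding B_def by (rule inv_trace_eq[symmetric]) (rule q_pos)
  finally show ?thesis by (rule sym)
qed

end
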